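(* Let $X\in\mathbb{R}^{d\times N}$, $Y\in\mathbb{R}^{d\times N}$, and $-\infty<\mu\le L<\infty$. There exists a symmetric matrix $Q\in\mathbb{R}^{d\times d}$ with $\mu I\preceq Q\preceq LI$ such that $Y=QX$ if, and only if, $$\begin{cases} X^TY=Y^TX,\\ (Y-\mu X)^T(LX-Y)\succeq 0.\end{cases}$$
   Context: All matrices are real. $\preceq$ (and $\succeq$) denotes the Löwner order on symmetric matrices ($A\preceq B$ iff $B-A$ is positive semidefinite). Under the first condition the matrix $(Y-\mu X)^T(LX-Y)$ is symmetric, so the second condition is meaningful. *)

theory Defs
  imports "HOL-Analysis.Analysis"
begin

definition symmetric_matrix :: "real^'n^'n \<Rightarrow> bool" where
  "symmetric_matrix A \<longleftrightarrow> transpose A = A"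

text \<open>Positive semidefiniteness includes symmetry; nonnegativity of the quadratic form alone
  would not imply it over the reals.\<close>

definition pos_semidef :: "real^'n^'n \<Rightarrow> bool" where
  "pos_semidef A \<longleftrightarrow> symmetric_matrix A \<and> (\<forall>x. 0 \<le> x \<bullet> (A *v x))"

text \<open>The Loewner order is an order on symmetric matrices, so it is false as soon as one of its
  arguments is not symmetric.\<close>

definition loewner_le :: "real^'n^'n \<Rightarrow> real^'n^'n \<Rightarrow> bool"  (infix "\<preceq>\<^sub>L" 50) where
  "A \<preceq>\<^sub>L B \<longleftrightarrow> symmetric_matrix A \<and> symmetric_matrix B \<and> pos_semidef (B - A)"

end

theory Submission
  imports Defs
begin

text \<open>Put \<open>P = Q - \<mu>I\<close>, \<open>A = Y - \<mu>X\<close> and \<open>M = L - \<mu>\<close>, so that we look for a symmetric \<open>P\<close> with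
  \<open>0 \<preceq> P \<preceq> M I\<close> and \<open>P X = A\<close>. For symmetric \<open>P\<close> these bounds are equivalent to
  \<open>P\<^sup>2 \<preceq> M P\<close>; multiplying by \<open>X\<close> from both sides gives \<open>A\<^sup>T A \<preceq> M A\<^sup>T X\<close>, which is the
  condition on \<open>X\<close> and \<open>Y\<close>. Conversely, this inequality shows that \<open>ker (A\<^sup>T X) \<subseteq> ker A\<close>, so
  for any generalized inverse \<open>H\<close> of \<open>G = A\<^sup>T X\<close> the matrix \<open>P = A H A\<^sup>T\<close> is symmetric, solves
  \<open>P X = A\<close>, and satisfies \<open>P\<^sup>2 = A H\<^sup>T (A\<^sup>T A) H A\<^sup>T \<preceq> M A H\<^sup>T G H A\<^sup>T = M P\<close>.\<close>

lemma inner_transpose_mult: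
  fixes A :: "real^'n^'m"
  shows "x \<bullet> (transpose A *v y) = (A *v x) \<bullet> y"
  by (metis dot_lmul_matrix inner_commute transpose_matrix_vector)

lemma symmetric_matrix_inner:
  fixes A :: "real^'n^'n"
  shows "symmetric_matrix A \<longleftrightarrow> (\<forall>x y. x \<bullet> (A *v y) = (A *v x) \<bullet> y)"
proof -
  have "symmetric_matrix A \<longleftrightarrow> (\<forall>y. transpose A *v y = A *v y)"
    by (simp only: symmetric_matrix_def matrix_eq)
  also have "\<dots> \<longleftrightarrow> (\<forall>x y. x \<bullet> (A *v y) = x \<bullet> (transpose A *v y))"
    by (metis vector_eq_ldot)
  finally show ?thesis
    by (simp only: inner_transpose_mult)
qed

lemma loewner_le_inner:
  "A \<preceq>\<^sub>L B \<longleftrightarrow> symmetric_matrix A \<and> symmetric_matrix B \<and> (\<forall>x. x \<bullet> (A *v x) \<le> x \<bullet> (B *v x))"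
  by (auto simp: loewner_le_def pos_semidef_def symmetric_matrix_inner
      matrix_vector_mult_diff_rdistrib inner_diff_right inner_diff_left)

lemma scaleR_mat_1_mult_vector [simp]: "(c *\<^sub>R mat 1) *v x = c *\<^sub>R (x :: real^'n)"
  using scaleR_matrix_vector_assoc[of c "mat 1" x] by simp

text \<open>Both conditions place the spectrum of \<open>P\<close> in \<open>[0, M]\<close>, but no
  diagonalization is used: one direction evaluates the quadratic form along the line
  \<open>x - t P x\<close>, the other is Cauchy-Schwarz.\<close>

lemma psd_upper_bound_iff:
  fixes P :: "real^'n^'n" and M :: real
  assumes "symmetric_matrix P" "0 \<le> M"
  shows "(\<forall>x. 0 \<le> x \<bullet> (P *v x) \<and> x \<bullet> (P *v x) \<le> M * (x \<bullet> x)) \<longleftrightarrow>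
         (\<forall>x. (P *v x) \<bullet> (P *v x) \<le> M * (x \<bullet> (P *v x)))"
proof (intro iffI allI)
  fix x
  assume bd: "\<forall>x. 0 \<le> x \<bullet> (P *v x) \<and> x \<bullet> (P *v x) \<le> M * (x \<bullet> x)"
  let ?y = "P *v x"
  \<comment> \<open>The form is nonnegative at \<open>x - t *\<^sub>R ?y\<close>; its
    \<open>t\<^sup>2\<close> term is enlarged by the upper bound at \<open>?y\<close>.\<close>
  have quad: "0 \<le> x \<bullet> ?y - 2 * t * (?y \<bullet> ?y) + t\<^sup>2 * (M * (?y \<bullet> ?y))" for t
  proof -
    have "x \<bullet> (P *v ?y) = ?y \<bullet> ?y"
      using assms(1) by (simp add: symmetric_matrix_inner)
    then have "(x - t *\<^sub>R ?y) \<bullet> (P *v (x - t *\<^sub>R ?y))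
        = x \<bullet> ?y - 2 * t * (?y \<bullet> ?y) + t\<^sup>2 * (?y \<bullet> (P *v ?y))"
      by (simp add: matrix_vector_mult_diff_distrib matrix_vector_mult_scaleR inner_diff_left
          inner_diff_right power2_eq_square algebra_simps)
    moreover have "t\<^sup>2 * (?y \<bullet> (P *v ?y)) \<le> t\<^sup>2 * (M * (?y \<bullet> ?y))"
      using bd by (intro mult_left_mono) auto
    ultimately show ?thesis
      using bd by (smt (verit))
  qed
  show "?y \<bullet> ?y \<le> M * (x \<bullet> ?y)"
  proof (cases "M = 0")
    case True
    then show ?thesis
      using quad[of 1] bd[rule_format, of x] inner_ge_zero[of ?y] by simp
  next
    case False
    with assms(2) have "M > 0" by simp
    \<comment> \<open>The choice \<open>t = 1 / M\<close> minimizes the bound, with value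
      \<open>x \<bullet> ?y - (?y \<bullet> ?y) / M\<close>.\<close>
    then show ?thesis
      using quad[of "1 / M"] by (simp add: field_simps power2_eq_square)
  qed
next
  fix x
  assume le: "\<forall>x. (P *v x) \<bullet> (P *v x) \<le> M * (x \<bullet> (P *v x))"
  let ?y = "P *v x"
  have sq: "(norm ?y)\<^sup>2 \<le> M * (x \<bullet> ?y)"
    using le by (simp add: power2_norm_eq_inner)
  have cs: "x \<bullet> ?y \<le> norm x * norm ?y"
    by (rule norm_cauchy_schwarz)
  \<comment> \<open>Chaining \<open>sq\<close> with \<open>cs\<close> leaves a common factor
    \<open>norm ?y\<close> to cancel.\<close>
  have "norm ?y * norm ?y \<le> (M * norm x) * norm ?y"
    using sq mult_left_mono[OF cs assms(2)] by (simp add: power2_eq_square algebra_simps)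
  then have bound: "norm ?y \<le> M * norm x"
    using assms(2) by (cases "norm ?y = 0") (auto simp: mult_le_cancel_right)
  have "0 \<le> x \<bullet> ?y"
  proof (cases "M = 0")
    case True
    then show ?thesis using sq by simp
  next
    case False
    have "0 \<le> M * (x \<bullet> ?y)" using sq by (smt (verit) zero_le_power2)
    with False assms(2) show ?thesis by (simp add: zero_le_mult_iff)
  qed
  moreover have "x \<bullet> ?y \<le> M * (x \<bullet> x)"
    using cs mult_left_mono[OF bound norm_ge_zero[of x]]
    by (simp add: power2_norm_eq_inner[symmetric] power2_eq_square algebra_simps)
  ultimately show "0 \<le> x \<bullet> ?y \<and> x \<bullet> ?y \<le> M * (x \<bullet> x)" ..
qed

text \<open>A linear right inverse \<open>h\<close> of \<open>G\<close> on its range satisfies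
  \<open>G (h (G w)) = G w\<close> for all \<open>w\<close>, so its matrix serves as
  \<open>H\<close>.\<close>

lemma generalized_inverse_exists:
  fixes G :: "real^'n^'m"
  shows "\<exists>H :: real^'m^'n. G ** H ** G = G"
proof -
  obtain h where h: "linear h" "\<forall>v\<in>range ((*v) G). G *v h v = v"
    using linear_exists_right_inverse_on[OF matrix_vector_mul_linear subspace_UNIV, of G] by blast
  have "G ** matrix h ** G = G"
    using h by (simp add: matrix_eq matrix_vector_mul_assoc[symmetric] matrix_works)
  then show ?thesis ..
qed

text \<open>With the bounds on \<open>P\<close> in squared form, the two inequalities are carried
  into each other by substitution: \<open>x = X w\<close> in one direction,
  \<open>w = H A\<^sup>T x\<close> in the other.\<close>

lemma symmetric_interpolation:
  fixes X A :: "real^'N^'d" and M :: real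
  shows "(\<exists>P :: real^'d^'d. symmetric_matrix P \<and>
            (\<forall>x. (P *v x) \<bullet> (P *v x) \<le> M * (x \<bullet> (P *v x))) \<and> P ** X = A)
         \<longleftrightarrow>
         (symmetric_matrix (transpose A ** X) \<and>
          (\<forall>w. (A *v w) \<bullet> (A *v w) \<le> M * ((A *v w) \<bullet> (X *v w))))"
    (is "?lhs \<longleftrightarrow> ?rhs")
proof
  assume ?lhs
  then obtain P :: "real^'d^'d" where P: "symmetric_matrix P" "P ** X = A"
    and le: "\<And>x. (P *v x) \<bullet> (P *v x) \<le> M * (x \<bullet> (P *v x))"
    by blast
  have "symmetric_matrix (transpose A ** X)"
    using P(1) unfolding P(2)[symmetric] symmetric_matrix_def
    by (simp add: matrix_transpose_mul matrix_mul_assoc)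
  moreover have "(A *v w) \<bullet> (A *v w) \<le> M * ((A *v w) \<bullet> (X *v w))" for w
    using le[of "X *v w"] unfolding P(2)[symmetric]
    by (simp add: matrix_vector_mul_assoc[symmetric] inner_commute)
  ultimately show ?rhs by blast
next
  assume ?rhs
  define G where "G = transpose A ** X"
  have G: "transpose G = G"
    and le: "\<And>w. (A *v w) \<bullet> (A *v w) \<le> M * ((A *v w) \<bullet> (X *v w))"
    using \<open>?rhs\<close> by (auto simp: G_def symmetric_matrix_def)
  have le': "(A *v w) \<bullet> (A *v w) \<le> M * (w \<bullet> (G *v w))" for w
    using le[of w] by (metis G_def inner_transpose_mult matrix_vector_mul_assoc)
  \<comment> \<open>Proved for an arbitrary generalized inverse, because it is applied to
    \<open>transpose H\<close> as well as to \<open>H\<close>.\<close>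
  have ker: "A ** H ** G = A" if "G ** H ** G = G" for H
  proof -
    have "A *v (H *v (G *v w)) = A *v w" for w
    proof -
      let ?v = "H *v (G *v w) - w"
      have "G *v ?v = 0"
        using that by (metis matrix_vector_mul_assoc matrix_vector_mult_diff_distrib
            cancel_comm_monoid_add_class.diff_cancel)
      then have "A *v ?v = 0"
        using le'[of ?v] by (metis inner_gt_zero_iff inner_zero_right mult_zero_right not_le)
      then show ?thesis
        by (simp add: matrix_vector_mult_diff_distrib)
    qed
    then show ?thesis
      by (simp add: matrix_eq matrix_vector_mul_assoc[symmetric])
  qed
  obtain H where H: "G ** H ** G = G"
    using generalized_inverse_exists by blast
  have HT: "G ** transpose H ** G = G"
    using arg_cong[OF H, of transpose] by (simp add: matrix_transpose_mul G matrix_mul_assoc)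
  have AT: "G ** H ** transpose A = transpose A"
    using arg_cong[OF ker[OF HT], of transpose]
    by (simp add: matrix_transpose_mul G matrix_mul_assoc)
  define P where "P = A ** H ** transpose A"
  \<comment> \<open>Inserting \<open>G ** H\<close> before the last factor and absorbing
    \<open>transpose H ** G\<close> into \<open>A\<close> trades \<open>transpose H\<close> for
    \<open>H\<close>, so \<open>P\<close> is symmetric even if \<open>H\<close> is not.\<close>
  have "A ** transpose H ** transpose A = A ** transpose H ** (G ** H ** transpose A)"
    by (simp add: AT)
  also have "\<dots> = (A ** transpose H ** G) ** H ** transpose A"
    by (simp add: matrix_mul_assoc)
  finally have P': "A ** transpose H ** transpose A = P"
    by (simp add: ker[OF HT] P_def)
  then have "symmetric_matrix P"
    by (simp add: symmetric_matrix_def P_def matrix_transpose_mul matrix_mul_assoc)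
  moreover have "P ** X = A"
    using ker[OF H] by (simp add: P_def G_def matrix_mul_assoc)
  moreover have "(P *v x) \<bullet> (P *v x) \<le> M * (x \<bullet> (P *v x))" for x
  proof -
    \<comment> \<open>At this vector \<open>A *v ?w = P *v x\<close> and
      \<open>G *v ?w = transpose A *v x\<close>, which turns \<open>le'\<close> into the
      claim.\<close>
    let ?w = "H *v (transpose A *v x)"
    have "A *v ?w = P *v x"
      by (simp only: P_def matrix_vector_mul_assoc matrix_mul_assoc)
    moreover have "G *v ?w = transpose A *v x"
      by (simp only: AT matrix_vector_mul_assoc matrix_mul_assoc)
    moreover have "?w \<bullet> (transpose A *v x) = x \<bullet> (A *v ?w)"
      by (metis inner_transpose_mult inner_commute)
    ultimately show ?thesis
      using le'[of ?w] by simp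
  qed
  ultimately show ?lhs by blast
qed

lemma transpose_diff: "transpose (A - B) = transpose A - transpose (B :: 'a::ab_group_add^'n^'m)"
  by (simp add: transpose_def vec_eq_iff)

lemma matrix_diff_ldistrib: "A ** (B - C) = A ** B - A ** (C :: 'a::ring_1^'n^'m)"
  by (vector matrix_matrix_mult_def sum_subtractf[symmetric] field_simps)

lemma matrix_diff_rdistrib: "(A - B) ** C = A ** C - B ** (C :: 'a::ring_1^'n^'m)"
  by (vector matrix_matrix_mult_def sum_subtractf[symmetric] field_simps)

theorem theorem3p3:
  fixes X Y :: "real^'N^'d" and \<mu> L :: real
  assumes "\<mu> \<le> L"
  shows "(\<exists>Q :: real^'d^'d. symmetric_matrix Q \<and>
            \<mu> *\<^sub>R mat 1 \<preceq>\<^sub>L Q \<and> Q \<preceq>\<^sub>L L *\<^sub>R mat 1 \<and> Y = Q ** X)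
         \<longleftrightarrow>
         (transpose X ** Y = transpose Y ** X \<and>
          0 \<preceq>\<^sub>L transpose (Y - \<mu> *\<^sub>R X) ** (L *\<^sub>R X - Y))"
    (is "?lhs \<longleftrightarrow> ?rhs")
proof -
  define A where "A = Y - \<mu> *\<^sub>R X"
  define M where "M = L - \<mu>"
  have "0 \<le> M"
    using assms by (simp add: M_def)
  let ?psd = "\<lambda>P :: real^'d^'d. \<forall>x. (P *v x) \<bullet> (P *v x) \<le> M * (x \<bullet> (P *v x))"
  have sym_shift: "symmetric_matrix (Q - \<mu> *\<^sub>R mat 1) \<longleftrightarrow> symmetric_matrix Q" for Q :: "real^'d^'d"
    by (simp add: symmetric_matrix_def transpose_diff transpose_scalar)
  have bounds: "\<mu> *\<^sub>R mat 1 \<preceq>\<^sub>L Q \<and> Q \<preceq>\<^sub>L L *\<^sub>R mat 1 \<longleftrightarrow> ?psd (Q - \<mu> *\<^sub>R mat 1)"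
    if "symmetric_matrix Q" for Q :: "real^'d^'d"
  proof -
    have "\<mu> *\<^sub>R mat 1 \<preceq>\<^sub>L Q \<and> Q \<preceq>\<^sub>L L *\<^sub>R mat 1 \<longleftrightarrow>
        (\<forall>x. \<mu> * (x \<bullet> x) \<le> x \<bullet> (Q *v x) \<and> x \<bullet> (Q *v x) \<le> L * (x \<bullet> x))"
      using that by (auto simp: loewner_le_inner symmetric_matrix_inner)
    also have "\<dots> \<longleftrightarrow> (\<forall>x. 0 \<le> x \<bullet> ((Q - \<mu> *\<^sub>R mat 1) *v x) \<and>
        x \<bullet> ((Q - \<mu> *\<^sub>R mat 1) *v x) \<le> M * (x \<bullet> x))"
      by (simp add: matrix_vector_mult_diff_rdistrib inner_diff_right M_def left_diff_distrib)
    also have "\<dots> \<longleftrightarrow> ?psd (Q - \<mu> *\<^sub>R mat 1)"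
      using that \<open>0 \<le> M\<close> by (intro psd_upper_bound_iff) (simp_all add: sym_shift)
    finally show ?thesis .
  qed
  have prod: "(Q - \<mu> *\<^sub>R mat 1) ** X = A \<longleftrightarrow> Y = Q ** X" for Q
    by (auto simp: A_def matrix_eq matrix_vector_mul_assoc[symmetric]
        matrix_vector_mult_diff_rdistrib scaleR_matrix_vector_assoc[symmetric])
  have "?lhs \<longleftrightarrow> (\<exists>Q. symmetric_matrix (Q - \<mu> *\<^sub>R mat 1) \<and> ?psd (Q - \<mu> *\<^sub>R mat 1) \<and>
      (Q - \<mu> *\<^sub>R mat 1) ** X = A)"
    unfolding sym_shift prod using bounds by blast
  \<comment> \<open>Every \<open>P\<close> arises from
    \<open>Q = P + \<mu> *\<^sub>R mat 1\<close>.\<close>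
  also have "\<dots> \<longleftrightarrow> (\<exists>P. symmetric_matrix P \<and> ?psd P \<and> P ** X = A)"
    by (metis add_diff_cancel_right')
  also have "\<dots> \<longleftrightarrow> symmetric_matrix (transpose A ** X) \<and>
      (\<forall>w. (A *v w) \<bullet> (A *v w) \<le> M * ((A *v w) \<bullet> (X *v w)))"
    by (rule symmetric_interpolation)
  also have "\<dots> \<longleftrightarrow> ?rhs"
  proof -
    \<comment> \<open>Subtracting \<open>\<mu> X\<^sup>T X\<close>, which is symmetric, from
      \<open>Y\<^sup>T X\<close> does not affect its symmetry.\<close>
    have sym: "symmetric_matrix (transpose A ** X) \<longleftrightarrow> transpose X ** Y = transpose Y ** X"
      by (simp add: symmetric_matrix_def A_def matrix_transpose_mul transpose_diff transpose_scalar
          matrix_diff_ldistrib matrix_diff_rdistrib scalar_matrix_assoc[symmetric] matrix_scalar_ac)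
    have B: "L *\<^sub>R X - Y = M *\<^sub>R X - A"
      by (simp add: A_def M_def algebra_simps)
    \<comment> \<open>The Loewner order also demands symmetry of the product; it equals
      \<open>M A\<^sup>T X - A\<^sup>T A\<close>.\<close>
    have "symmetric_matrix (transpose A ** (M *\<^sub>R X - A))" if "symmetric_matrix (transpose A ** X)"
      using that by (simp add: symmetric_matrix_def matrix_transpose_mul transpose_diff transpose_scalar
          matrix_diff_ldistrib matrix_diff_rdistrib scalar_matrix_assoc[symmetric] matrix_scalar_ac)
    moreover have "w \<bullet> ((transpose A ** (M *\<^sub>R X - A)) *v w) =
        M * ((A *v w) \<bullet> (X *v w)) - (A *v w) \<bullet> (A *v w)" for w
      by (simp add: inner_transpose_mult matrix_vector_mul_assoc[symmetric]
          matrix_vector_mult_diff_rdistrib scaleR_matrix_vector_assoc[symmetric] inner_diff_right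
          del: transpose_matrix_vector)
    ultimately show ?thesis
      unfolding sym[symmetric] B A_def[symmetric] loewner_le_inner
      by (auto simp: symmetric_matrix_inner)
  qed
  finally show ?thesis .
qed

end
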